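(* Let $(A_n,B_n)_{n\ge2}$ be the twin Seidel matrix sequence, $B_n=(b_n(m,k))$. Then, as formal power series in $x,y,z$, $$\sum b_{2n}(m,k)\frac{x^{m-1}}{(m-1)!}\frac{y^{k-m-1}}{(k-m-1)!}\frac{z^{2n-1-k}}{(2n-1-k)!}=\frac{\sin x\,\cos z}{\cos^2(x+y+z)},$$ the sum being over all integers $n\ge1$, $m,k$ with $2\le m+1\le k\le 2n-1$, and $$\sum b_{2n}(m,k)\frac{x^{2n-m-1}}{(2n-m-1)!}\frac{y^{m-k-1}}{(m-k-1)!}\frac{z^{k-1}}{(k-1)!}=\frac{\cos(x+y)\,\sin(y+z)}{\cos^2(x+y+z)},$$ the sum being over all integers $n\ge1$, $m,k$ with $2\le k+1\le m\le 2n-1$.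
   Context: Twin Seidel matrix sequence: the unique sequence of square matrices $A_n=(a_n(m,k))_{1\le m,k\le n}$, $B_n=(b_n(m,k))_{1\le m,k\le n}$ ($n\ge2$) with nonnegative integer entries satisfying, with $a_n(m,\bullet)=\sum_k a_n(m,k)$, $a_n(\bullet,k)=\sum_m a_n(m,k)$ and similarly for $b$: (TS1) all diagonal entries are $0$, except $a_2(1,1)=1$; (TS2) for $n\ge3$: $a_n(m,n)=b_n(m,n)=0$ for all $m$, $a_n(n,k)=b_n(1,k)=0$ for all $k$, and $b_n(n,1)=0$; (TS3) $A_2=\begin{pmatrix}1&0\\0&0\end{pmatrix}$, $B_2=\begin{pmatrix}0&0\\1&0\end{pmatrix}$; (TS4) for $n\ge3$: $b_n(n,k)=a_{n-1}(\bullet,k-1)$ for $2\le k\le n-1$; $b_n(n-1,k)=a_{n-1}(\bullet,k)$ for $1\le k\le n-2$; $b_n(m+1,k)-b_n(m,k)=a_{n-1}(m,k)$ for $2\le k+1\le m\le n-2$; $b_n(m+1,k)-b_n(m,k)=a_{n-1}(m,k-1)$ for $3\le m+2\le k\le n-1$; (TS5) for $n\ge3$: $a_n(1,k)=b_{n-1}(\bullet,k-1)$ for $2\le k\le n-1$; $a_n(m+1,k)-a_n(m,k)=-b_{n-1}(m,k-1)$ for $3\le m+2\le k\le n-1$; $a_n(m+1,k)-a_n(m,k)=-b_{n-1}(m,k)$ for $2\le k+1\le m\le n-1$. *)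

theory Defs
  imports "HOL-Computational_Algebra.Formal_Power_Series"
begin

section \<open>Twin Seidel matrix sequences\<close>

text \<open>
  \<open>a n m k\<close> and \<open>b n m k\<close> are the entries in row \<open>m\<close> and column \<open>k\<close> of the \<open>n \<times> n\<close> matrices
  \<open>A\<^sub>n\<close> and \<open>B\<^sub>n\<close>.  Only the values with \<open>n \<ge> 2\<close> and \<open>1 \<le> m, k \<le> n\<close> are meaningful, and the
  others are unconstrained.
\<close>

definition col_sum :: "(nat \<Rightarrow> nat \<Rightarrow> nat \<Rightarrow> int) \<Rightarrow> nat \<Rightarrow> nat \<Rightarrow> int" where
  "col_sum a n k = (\<Sum>m=1..n. a n m k)"

definition twin_seidel ::
    "(nat \<Rightarrow> nat \<Rightarrow> nat \<Rightarrow> int) \<Rightarrow> (nat \<Rightarrow> nat \<Rightarrow> nat \<Rightarrow> int) \<Rightarrow> bool" where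
  "twin_seidel a b \<longleftrightarrow>
     (\<forall>n\<ge>2. \<forall>m\<in>{1..n}. \<forall>k\<in>{1..n}. 0 \<le> a n m k \<and> 0 \<le> b n m k) \<and>
     (\<forall>n\<ge>2. \<forall>m\<in>{1..n}. a n m m = (if n = 2 \<and> m = 1 then 1 else 0) \<and> b n m m = 0) \<and>
     (\<forall>n\<ge>3. (\<forall>m\<in>{1..n}. a n m n = 0 \<and> b n m n = 0) \<and>
             (\<forall>k\<in>{1..n}. a n n k = 0 \<and> b n 1 k = 0) \<and>
             b n n 1 = 0) \<and>
     (a 2 1 1 = 1 \<and> a 2 1 2 = 0 \<and> a 2 2 1 = 0 \<and> a 2 2 2 = 0) \<and>
     (b 2 1 1 = 0 \<and> b 2 1 2 = 0 \<and> b 2 2 1 = 1 \<and> b 2 2 2 = 0) \<and>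
     (\<forall>n\<ge>3.
       (\<forall>k. 2 \<le> k \<and> k \<le> n - 1 \<longrightarrow> b n n k = col_sum a (n - 1) (k - 1)) \<and>
       (\<forall>k. 1 \<le> k \<and> k \<le> n - 2 \<longrightarrow> b n (n - 1) k = col_sum a (n - 1) k) \<and>
       (\<forall>m k. 2 \<le> k + 1 \<and> k + 1 \<le> m \<and> m \<le> n - 2 \<longrightarrow>
          b n (m + 1) k - b n m k = a (n - 1) m k) \<and>
       (\<forall>m k. 3 \<le> m + 2 \<and> m + 2 \<le> k \<and> k \<le> n - 1 \<longrightarrow>
          b n (m + 1) k - b n m k = a (n - 1) m (k - 1))) \<and>
     (\<forall>n\<ge>3.
       (\<forall>k. 2 \<le> k \<and> k \<le> n - 1 \<longrightarrow> a n 1 k = col_sum b (n - 1) (k - 1)) \<and>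
       (\<forall>m k. 3 \<le> m + 2 \<and> m + 2 \<le> k \<and> k \<le> n - 1 \<longrightarrow>
          a n (m + 1) k - a n m k = - b (n - 1) m (k - 1)) \<and>
       (\<forall>m k. 2 \<le> k + 1 \<and> k + 1 \<le> m \<and> m \<le> n - 1 \<longrightarrow>
          a n (m + 1) k - a n m k = - b (n - 1) m k))"

text \<open>
  Existence: solving the difference equations expresses every entry as a sum of entries of the
  preceding matrices, so that nonnegativity is inherited.
\<close>

fun ts_step :: "nat \<Rightarrow> (nat \<Rightarrow> nat \<Rightarrow> int) \<times> (nat \<Rightarrow> nat \<Rightarrow> int) \<Rightarrow>
    (nat \<Rightarrow> nat \<Rightarrow> int) \<times> (nat \<Rightarrow> nat \<Rightarrow> int)" where
  "ts_step n (a, b) =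
     (\<lambda>m k. if k \<ge> n \<or> m = k then 0
            else if m < k then (\<Sum>j=m..<n. b j (k - 1))
            else (\<Sum>j=m..<n. b j k),
      \<lambda>m k. if k \<ge> n \<or> m = k \<or> m = n \<and> k = 1 then 0
            else if m < k \<or> m = n then (\<Sum>j=1..<m. a j (k - 1))
            else (\<Sum>j=1..<m. a j k) + a (n - 1) k)"

fun ts_mat :: "nat \<Rightarrow> (nat \<Rightarrow> nat \<Rightarrow> int) \<times> (nat \<Rightarrow> nat \<Rightarrow> int)" where
  "ts_mat 0 = (\<lambda>m k. if m = 1 \<and> k = 1 then 1 else 0, \<lambda>m k. if m = 2 \<and> k = 1 then 1 else 0)"
| "ts_mat (Suc i) = ts_step (i + 3) (ts_mat i)"

lemma ts_mat_nonneg: "0 \<le> fst (ts_mat i) m k \<and> 0 \<le> snd (ts_mat i) m k"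
proof (induction i arbitrary: m k)
  case 0
  then show ?case by simp
next
  case (Suc i)
  obtain a b where ab: "ts_mat i = (a, b)" by (cases "ts_mat i")
  have nn: "0 \<le> a m k" "0 \<le> b m k" for m k
    using Suc[of m k] ab by auto
  show ?case
    by (auto simp: ab nn intro!: sum_nonneg add_nonneg_nonneg)
qed

lemma twin_seidel_exists: "\<exists>a b. twin_seidel a b"
proof -
  define a where "a n = fst (ts_mat (n - 2))" for n
  define b where "b n = snd (ts_mat (n - 2))" for n
  have a_rec: "a n m k = (if k \<ge> n \<or> m = k then 0
            else if m < k then (\<Sum>j=m..<n. b (n - 1) j (k - 1))
            else (\<Sum>j=m..<n. b (n - 1) j k))"
   and b_rec: "b n m k = (if k \<ge> n \<or> m = k \<or> m = n \<and> k = 1 then 0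
            else if m < k \<or> m = n then (\<Sum>j=1..<m. a (n - 1) j (k - 1))
            else (\<Sum>j=1..<m. a (n - 1) j k) + a (n - 1) (n - 1) k)"
    if n: "n \<ge> 3" for n m k
  proof -
    define i where "i = n - 3"
    have i: "n = i + 3" using n by (simp add: i_def)
    obtain a' b' where ab: "ts_mat i = (a', b')" by (cases "ts_mat i")
    have *: "n - 2 = Suc i" "n - 1 - 2 = i" using i by auto
    show "a n m k = (if k \<ge> n \<or> m = k then 0
            else if m < k then (\<Sum>j=m..<n. b (n - 1) j (k - 1))
            else (\<Sum>j=m..<n. b (n - 1) j k))"
      unfolding a_def b_def * by (simp add: ab i)
    show "b n m k = (if k \<ge> n \<or> m = k \<or> m = n \<and> k = 1 then 0
            else if m < k \<or> m = n then (\<Sum>j=1..<m. a (n - 1) j (k - 1))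
            else (\<Sum>j=1..<m. a (n - 1) j k) + a (n - 1) (n - 1) k)"
      unfolding a_def b_def * by (simp add: ab i)
  qed
  have nn: "0 \<le> a n m k" "0 \<le> b n m k" for n m k
    using ts_mat_nonneg by (auto simp: a_def b_def)
  have a2: "a 2 m k = (if m = 1 \<and> k = 1 then 1 else 0)"
   and b2: "b 2 m k = (if m = 2 \<and> k = 1 then 1 else 0)" for m k
    by (simp_all add: a_def b_def)
  have ivl: "{Suc 0..n - Suc 0} = {Suc 0..<n}" for n :: nat by auto
  have "twin_seidel a b"
    unfolding twin_seidel_def
  proof (intro conjI allI ballI impI; (elim conjE)?)
    fix n m assume *: "(2::nat) \<le> n" "m \<in> {1..n}"
    show "a n m m = (if n = 2 \<and> m = 1 then 1 else 0)" "b n m m = 0"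
      using * a_rec[of n m m] b_rec[of n m m] by (cases "n = 2"; auto simp: a2 b2)+
  next
    fix n k assume n: "(3::nat) \<le> n" and k: "1 \<le> k" "k \<le> n - 2"
    have k': "k < n - 1" using n k by auto
    have "{1..<n} = insert (n - 1) {1..<n - 1}" using n by auto
    hence "col_sum a (n - 1) k = (\<Sum>j=1..<n - 1. a (n - 1) j k) + a (n - 1) (n - 1) k"
      using ivl[of n] by (simp add: col_sum_def)
    thus "b n (n - 1) k = col_sum a (n - 1) k"
      using n k k' by (auto simp: b_rec)
  next
    fix n m k assume n: "(3::nat) \<le> n" and k: "k + 1 \<le> m" "m \<le> n - 1"
    have "{m..<n} = insert m {m + 1..<n}" using n k by auto
    thus "a n (m + 1) k - a n m k = - b (n - 1) m k"
      using n k by (simp add: a_rec)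
  next
    fix n m k assume n: "(3::nat) \<le> n" and k: "m + 2 \<le> k" "k \<le> n - 1"
    have "{m..<n} = insert m {m + 1..<n}" using n k by auto
    thus "a n (m + 1) k - a n m k = - b (n - 1) m (k - 1)"
      using n k by (simp add: a_rec)
  next
    fix n m k assume n: "(3::nat) \<le> n" and k: "2 \<le> k + 1" "k + 1 \<le> m" "m \<le> n - 2"
    have "{1..<m + 1} = insert m {1..<m}" using n k by auto
    moreover have "m + 1 < n" "k < n" using n k by auto
    ultimately show "b n (m + 1) k - b n m k = a (n - 1) m k"
      using n k by (simp add: b_rec)
  next
    fix n m k assume n: "(3::nat) \<le> n" and k: "3 \<le> m + 2" "m + 2 \<le> k" "k \<le> n - 1"
    have "{1..<m + 1} = insert m {1..<m}" using n k by auto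
    moreover have "m + 1 < n" "k < n" using n k by auto
    ultimately show "b n (m + 1) k - b n m k = a (n - 1) m (k - 1)"
      using n k by (simp add: b_rec)
  qed (auto simp: nn a2 b2 a_rec b_rec col_sum_def ivl)
  thus ?thesis by blast
qed

section \<open>Formal power series in three variables\<close>

text \<open>
  Series in \<open>x\<close>, \<open>y\<close>, \<open>z\<close> are iterated univariate series: the outermost variable is \<open>x\<close>, the
  innermost one \<open>z\<close>.
\<close>

type_synonym fps3 = "real fps fps fps"

definition coeff3 :: "fps3 \<Rightarrow> nat \<Rightarrow> nat \<Rightarrow> nat \<Rightarrow> real" where
  "coeff3 f p q r = fps_nth (fps_nth (fps_nth f p) q) r"

definition const3 :: "real \<Rightarrow> fps3" where
  "const3 c = fps_const (fps_const (fps_const c))"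

definition varx :: fps3 where "varx = fps_X"
definition vary :: fps3 where "vary = fps_const fps_X"
definition varz :: fps3 where "varz = fps_const (fps_const fps_X)"

text \<open>
  Substitution of a trivariate series \<open>g\<close> without constant term into a univariate series \<open>f\<close>,
  analogous to \<^const>\<open>fps_compose\<close>: since \<open>g\<close> has no constant term, the monomials of degree \<open>d\<close>
  receive contributions only from \<open>g ^ n\<close> with \<open>n \<le> d\<close>.
\<close>

definition subst3 :: "real fps \<Rightarrow> fps3 \<Rightarrow> fps3" where
  "subst3 f g =
     Abs_fps (\<lambda>p. Abs_fps (\<lambda>q. Abs_fps (\<lambda>r. \<Sum>n=0..p+q+r. fps_nth f n * coeff3 (g ^ n) p q r)))"

definition sin3 :: "fps3 \<Rightarrow> fps3" where "sin3 g = subst3 (fps_sin 1) g"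
definition cos3 :: "fps3 \<Rightarrow> fps3" where "cos3 g = subst3 (fps_cos 1) g"

text \<open>
  Formal summation of a family of series: each monomial occurs in only finitely many members of
  the family, and the coefficients are added up.
\<close>

definition has_formal_sum :: "('i \<Rightarrow> fps3) \<Rightarrow> 'i set \<Rightarrow> fps3 \<Rightarrow> bool" where
  "has_formal_sum F I S \<longleftrightarrow>
     (\<forall>p q r. finite {i \<in> I. coeff3 (F i) p q r \<noteq> 0} \<and>
              coeff3 S p q r = (\<Sum>i | i \<in> I \<and> coeff3 (F i) p q r \<noteq> 0. coeff3 (F i) p q r))"

text \<open>
  The library's division on iterated power series is genuine division whenever the denominator
  has nonzero constant term.
\<close>

lemma fps_divide_by_unit:
  fixes f g :: "'a::{comm_ring_1,inverse} fps"
  assumes "fps_nth g 0 * inverse (fps_nth g 0) = 1"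
  shows "g * inverse g = 1" and "f / g = f * inverse g" and "f / g * g = f"
proof -
  show 1: "g * inverse g = 1"
    unfolding fps_inverse_def using assms by (rule fps_right_inverse)
  have "fps_nth g 0 \<noteq> 0"
    using assms by auto
  hence "subdegree g = 0"
    by simp
  thus 2: "f / g = f * inverse g"
    by (simp add: fps_divide_def)
  show "f / g * g = f"
    unfolding 2 using 1 by (metis mult.assoc mult.commute mult.right_neutral)
qed

lemma fps3_divide_mult:
  fixes f g :: fps3
  assumes "coeff3 g 0 0 0 \<noteq> 0"
  shows "f / g * g = f"
  using assms by (intro fps_divide_by_unit) (simp add: coeff3_def)

lemma coeff3_cos3_square_0: "coeff3 (cos3 g ^ 2) 0 0 0 = 1"
  by (simp add: coeff3_def cos3_def subst3_def fps_cos_def power2_eq_square)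

end

theory Submission
  imports Defs
begin

text \<open>
  Index the entries strictly above and strictly below the diagonal by the exponents of the three
  variables.  In terms of exponential generating functions, the difference equations say that
  \<open>\<partial>\<^sub>x - \<partial>\<^sub>y\<close> rotates the pair of series belonging to \<open>A\<close> and \<open>B\<close>, while the column sum
  conditions telescope to boundary conditions on the planes \<open>x = 0\<close> and \<open>y = 0\<close>.  These conditions
  determine all coefficients by induction on the total degree, and they are satisfied by
  \<open>cos x cos z\<close>, \<open>sin x cos z\<close>, \<open>cos (x + y) cos (y + z)\<close> and \<open>cos (x + y) sin (y + z)\<close>, each
  divided by \<open>cos\<^sup>2 (x + y + z)\<close>: the denominator is annihilated by \<open>\<partial>\<^sub>x - \<partial>\<^sub>y\<close>.
\<close>

section \<open>Recurrences for the entries\<close>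

text \<open>\<open>ua\<close>, \<open>la\<close> and \<open>ub\<close>, \<open>lb\<close> model the
  parts of the A- and B-matrices above and below the diagonal. Factorials are cleared, so raising an
  index is a partial derivative of the generating function.\<close>

definition seidel_system ::
    "(nat \<Rightarrow> nat \<Rightarrow> nat \<Rightarrow> real) \<Rightarrow> (nat \<Rightarrow> nat \<Rightarrow> nat \<Rightarrow> real) \<Rightarrow>
     (nat \<Rightarrow> nat \<Rightarrow> nat \<Rightarrow> real) \<Rightarrow> (nat \<Rightarrow> nat \<Rightarrow> nat \<Rightarrow> real) \<Rightarrow> bool" where
  "seidel_system ua la ub lb \<longleftrightarrow>
     (\<forall>p q r. ua (Suc p) q r - ua p (Suc q) r = - ub p q r) \<and>
     (\<forall>p q r. ub (Suc p) q r - ub p (Suc q) r = ua p q r) \<and>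
     (\<forall>p q r. la p (Suc q) r - la (Suc p) q r = - lb p q r) \<and>
     (\<forall>p q r. lb p (Suc q) r - lb (Suc p) q r = la p q r) \<and>
     (\<forall>p r. ua p 0 r = la r 0 p) \<and>
     (\<forall>p r. lb p 0 r = ub r 0 p) \<and>
     (\<forall>q r. ub 0 q r = 0) \<and>
     (\<forall>q r. la 0 q (Suc r) = lb 0 q r) \<and>
     (\<forall>q. la 0 (Suc q) 0 = 0) \<and>
     la 0 0 0 = 1"

text \<open>Within one total degree the order is \<open>la\<close>, \<open>ua\<close>,
  \<open>ub\<close>, \<open>lb\<close>: \<open>la\<close> and \<open>ub\<close> start at
  \<open>p = 0\<close>, \<open>ua\<close> and \<open>lb\<close> start at \<open>q = 0\<close> from
  \<open>la\<close> and \<open>ub\<close>. The difference equations then move one unit between the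
  first two indices at the cost of an entry of smaller degree.\<close>

lemma seidel_system_unique:
  assumes "seidel_system ua la ub lb" and "seidel_system ua' la' ub' lb'"
  shows "ua p q r = ua' p q r \<and> la p q r = la' p q r \<and> ub p q r = ub' p q r \<and> lb p q r = lb' p q r"
proof (induction "p + q + r" arbitrary: p q r rule: less_induct)
  case less
  note S = assms[unfolded seidel_system_def]
  have IH: "ua p' q' r' = ua' p' q' r'" "la p' q' r' = la' p' q' r'"
    "ub p' q' r' = ub' p' q' r'" "lb p' q' r' = lb' p' q' r'"
    if "p' + q' + r' < p + q + r" for p' q' r'
    using less that by blast+
  have la: "la p' q' r' = la' p' q' r'" if "p' + q' + r' = p + q + r" for p' q' r'
    using that
  proof (induction p' arbitrary: q')
    case 0
    \<comment> \<open>At \<open>p' = 0\<close> the value comes from \<open>lb\<close> one degree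
      lower, or is the constant 0 or 1 if \<open>r' = 0\<close>.\<close>
    show ?case
    proof (cases r')
      case (Suc i)
      then show ?thesis using S IH(4)[of 0 q' i] 0 by simp
    next
      case 0
      then show ?thesis using S by (cases q') auto
    qed
  next
    case (Suc i)
    have "la (Suc i) q' r' = la i (Suc q') r' + lb i q' r'"
      "la' (Suc i) q' r' = la' i (Suc q') r' + lb' i q' r'"
      using S by (smt (verit))+
    then show ?case using Suc IH(4)[of i q' r'] by simp
  qed
  have ua: "ua p' q' r' = ua' p' q' r'" if "p' + q' + r' = p + q + r" for p' q' r'
    using that
  proof (induction q' arbitrary: p')
    case 0
    then show ?case using S la[of r' 0 p'] by simp
  next
    case (Suc i)
    have "ua p' (Suc i) r' = ua (Suc p') i r' + ub p' i r'"
      "ua' p' (Suc i) r' = ua' (Suc p') i r' + ub' p' i r'"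
      using S by (smt (verit))+
    then show ?case using Suc IH(3)[of p' i r'] by simp
  qed
  have ub: "ub p' q' r' = ub' p' q' r'" if "p' + q' + r' = p + q + r" for p' q' r'
    using that
  proof (induction p' arbitrary: q')
    case 0
    then show ?case using S by simp
  next
    case (Suc i)
    have "ub (Suc i) q' r' = ub i (Suc q') r' + ua i q' r'"
      "ub' (Suc i) q' r' = ub' i (Suc q') r' + ua' i q' r'"
      using S by (smt (verit))+
    then show ?case using Suc IH(1)[of i q' r'] by simp
  qed
  have lb: "lb p' q' r' = lb' p' q' r'" if "p' + q' + r' = p + q + r" for p' q' r'
    using that
  proof (induction q' arbitrary: p')
    case 0
    then show ?case using S ub[of r' 0 p'] by simp
  next
    case (Suc i)
    have "lb p' (Suc i) r' = lb (Suc p') i r' + la p' i r'"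
      "lb' p' (Suc i) r' = lb' (Suc p') i r' + la' p' i r'"
      using S by (smt (verit))+
    then show ?case using Suc IH(2)[of p' i r'] by simp
  qed
  show ?case using ua la ub lb by blast
qed

text \<open>Inverts \<open>p = m - 1\<close>, \<open>q = k - m - 1\<close>,
  \<open>r = n - 1 - k\<close>, so the triples run through the positions \<open>m < k < n\<close>.
  For \<open>lower_entry\<close> the exponents are \<open>p = n - m - 1\<close>,
  \<open>q = m - k - 1\<close>, \<open>r = k - 1\<close>, with \<open>k < m < n\<close>.\<close>

definition upper_entry :: "(nat \<Rightarrow> nat \<Rightarrow> nat \<Rightarrow> int) \<Rightarrow> nat \<Rightarrow> nat \<Rightarrow> nat \<Rightarrow> int" where
  "upper_entry a p q r = a (p + q + r + 3) (p + 1) (p + q + 2)"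

definition lower_entry :: "(nat \<Rightarrow> nat \<Rightarrow> nat \<Rightarrow> int) \<Rightarrow> nat \<Rightarrow> nat \<Rightarrow> nat \<Rightarrow> int" where
  "lower_entry a p q r = a (p + q + r + 3) (q + r + 2) (r + 1)"

lemma col_sum_split:
  assumes "k \<in> {1..<n}"
  shows "col_sum c n k =
    (\<Sum>m=1..<k. c n m k) + c n k k + (\<Sum>m=Suc k..<n. c n m k) + c n n k"
proof -
  have "{1..n} = {1..<k} \<union> {k} \<union> {Suc k..<n} \<union> {n}" using assms by auto
  then show ?thesis
    unfolding col_sum_def using assms
    by (simp add: sum.union_disjoint sum.insert_if add.assoc)
qed

section \<open>The entries of a twin Seidel sequence satisfy the system\<close>

context
  fixes a b
  assumes ts: "twin_seidel a b"
begin

lemma ts_diag: "n \<ge> 3 \<Longrightarrow> m \<in> {1..n} \<Longrightarrow> a n m m = 0"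
  "n \<ge> 2 \<Longrightarrow> m \<in> {1..n} \<Longrightarrow> b n m m = 0"
  using ts unfolding twin_seidel_def by auto

lemma ts_last_row: "n \<ge> 3 \<Longrightarrow> k \<in> {1..n} \<Longrightarrow> a n n k = 0"
  using ts unfolding twin_seidel_def by auto

lemma ts_first_row: "n \<ge> 3 \<Longrightarrow> k \<in> {1..n} \<Longrightarrow> b n 1 k = 0"
  using ts unfolding twin_seidel_def by auto

lemma ts_corner: "n \<ge> 3 \<Longrightarrow> b n n 1 = 0" "b 2 2 1 = 1"
  using ts unfolding twin_seidel_def by auto

lemma ts_col_sum:
  "n \<ge> 3 \<Longrightarrow> 2 \<le> k \<Longrightarrow> k \<le> n - 1 \<Longrightarrow> b n n k = col_sum a (n - 1) (k - 1)"
  "n \<ge> 3 \<Longrightarrow> 1 \<le> k \<Longrightarrow> k \<le> n - 2 \<Longrightarrow> b n (n - 1) k = col_sum a (n - 1) k"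
  "n \<ge> 3 \<Longrightarrow> 2 \<le> k \<Longrightarrow> k \<le> n - 1 \<Longrightarrow> a n 1 k = col_sum b (n - 1) (k - 1)"
  using ts unfolding twin_seidel_def by blast+

text \<open>Solved for the entry of order \<open>n - 1\<close>, the form in which column sums
  telescope.\<close>

lemma ts_diff:
  "n \<ge> 3 \<Longrightarrow> 2 \<le> k + 1 \<Longrightarrow> k + 1 \<le> m \<Longrightarrow> m \<le> n - 2 \<Longrightarrow> a (n - 1) m k = b n (m + 1) k - b n m k"
  "n \<ge> 3 \<Longrightarrow> 3 \<le> m + 2 \<Longrightarrow> m + 2 \<le> k \<Longrightarrow> k \<le> n - 1 \<Longrightarrow>
    a (n - 1) m (k - 1) = b n (m + 1) k - b n m k"
  "n \<ge> 3 \<Longrightarrow> 2 \<le> k + 1 \<Longrightarrow> k + 1 \<le> m \<Longrightarrow> m \<le> n - 1 \<Longrightarrow> b (n - 1) m k = a n m k - a n (m + 1) k"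
  "n \<ge> 3 \<Longrightarrow> 3 \<le> m + 2 \<Longrightarrow> m + 2 \<le> k \<Longrightarrow> k \<le> n - 1 \<Longrightarrow>
    b (n - 1) m (k - 1) = a n m k - a n (m + 1) k"
  using ts unfolding twin_seidel_def by (smt (verit))+

text \<open>One row down in a fixed column of order \<open>p + q + r + 4\<close> moves a unit from
  \<open>q\<close> to \<open>p\<close> above the diagonal, and from \<open>p\<close> to
  \<open>q\<close> below it.\<close>

lemma entry_diff:
  "upper_entry a (Suc p) q r - upper_entry a p (Suc q) r = - upper_entry b p q r"
  "upper_entry b (Suc p) q r - upper_entry b p (Suc q) r = upper_entry a p q r"
  "lower_entry a p (Suc q) r - lower_entry a (Suc p) q r = - lower_entry b p q r"
  "lower_entry b p (Suc q) r - lower_entry b (Suc p) q r = lower_entry a p q r"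
  using ts_diff(4)[of "p + q + r + 4" "p + 1" "p + q + 3"]
    ts_diff(2)[of "p + q + r + 4" "p + 1" "p + q + 3"]
    ts_diff(3)[of "p + q + r + 4" "r + 1" "q + r + 2"]
    ts_diff(1)[of "p + q + r + 4" "r + 1" "q + r + 2"]
  by (simp_all add: upper_entry_def lower_entry_def eval_nat_numeral)

text \<open>On the diagonal \<open>y = 0\<close>, the column sums telescope: what remains of them is the agreement
  of the entries directly above and directly below the main diagonal.\<close>

lemma entry_diagonal_a: "upper_entry a p 0 r = lower_entry a r 0 p"
proof -
  define n where "n = p + r + 3"
  have sum1: "(\<Sum>m=1..<p+1. b (n - 1) m (p + 1)) =
      (\<Sum>m=1..<p+1. a n m (p + 2) - a n (Suc m) (p + 2))"
    using ts_diff(4)[of n _ "p + 2"] by (intro sum.cong) (auto simp: n_def)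
  have sum2: "(\<Sum>m=Suc (p+1)..<n-1. b (n - 1) m (p + 1)) =
      (\<Sum>m=Suc (p+1)..<n-1. a n m (p + 1) - a n (Suc m) (p + 1))"
    using ts_diff(3)[of n "p + 1"] by (intro sum.cong) (auto simp: n_def)
  \<comment> \<open>Row \<open>n\<close> of the A-matrix vanishes, which closes the telescoping at
    the bottom.\<close>
  have last: "b (n - 1) (n - 1) (p + 1) = a n (n - 1) (p + 1)"
    using ts_diff(3)[of n "p + 1" "n - 1"] ts_last_row[of n "p + 1"]
    by (simp add: n_def eval_nat_numeral)
  have "a n 1 (p + 2) = col_sum b (n - 1) (p + 1)"
    using ts_col_sum(3)[of n "p + 2"] by (simp add: n_def)
  also have "\<dots> = (\<Sum>m=1..<p+1. b (n - 1) m (p + 1)) + (\<Sum>m=Suc (p+1)..<n-1. b (n - 1) m (p + 1))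
      + b (n - 1) (n - 1) (p + 1)"
    using col_sum_split[of "p + 1" "n - 1" b] ts_diag(2)[of "n - 1" "p + 1"] by (simp add: n_def)
  also have "\<dots> = a n 1 (p + 2) - a n (p + 1) (p + 2) + a n (p + 2) (p + 1)"
    unfolding sum1 sum2 last
    using sum_Suc_diff'[of 1 "p + 1" "\<lambda>m. - a n m (p + 2)"]
      sum_Suc_diff'[of "Suc (p + 1)" "n - 1" "\<lambda>m. - a n m (p + 1)"]
    by (simp add: n_def)
  finally show ?thesis by (simp add: upper_entry_def lower_entry_def n_def add_ac)
qed

text \<open>For \<open>p = r = 0\<close> the column sum would have order 2, where
  \<open>a 2 1 1 = 1\<close> spoils the cancellation. Otherwise \<open>n - 1 \<ge> 3\<close>, so the
  diagonal and the last row of that order vanish.\<close>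

lemma entry_diagonal_b:
  assumes "p + r > 0"
  shows "lower_entry b p 0 r = upper_entry b r 0 p"
proof -
  define n where "n = p + r + 3"
  have n: "n \<ge> 4" using assms by (simp add: n_def del: add_gr_0)
  have sum1: "(\<Sum>m=1..<r+1. a (n - 1) m (r + 1)) =
      (\<Sum>m=1..<r+1. b n (Suc m) (r + 2) - b n m (r + 2))"
    using ts_diff(2)[of n _ "r + 2"] by (intro sum.cong) (auto simp: n_def)
  have sum2: "(\<Sum>m=Suc (r+1)..<n-1. a (n - 1) m (r + 1)) =
      (\<Sum>m=Suc (r+1)..<n-1. b n (Suc m) (r + 1) - b n m (r + 1))"
    using ts_diff(1)[of n "r + 1"] by (intro sum.cong) (auto simp: n_def)
  have "b n (n - 1) (r + 1) = col_sum a (n - 1) (r + 1)"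
    using ts_col_sum(2)[of n "r + 1"] by (simp add: n_def)
  also have "\<dots> = (\<Sum>m=1..<r+1. a (n - 1) m (r + 1)) + (\<Sum>m=Suc (r+1)..<n-1. a (n - 1) m (r + 1))"
    using col_sum_split[of "r + 1" "n - 1" a] ts_diag(1)[of "n - 1" "r + 1"]
      ts_last_row[of "n - 1" "r + 1"] n by (simp add: n_def)
  also have "\<dots> = b n (r + 1) (r + 2) + b n (n - 1) (r + 1) - b n (r + 2) (r + 1)"
    unfolding sum1 sum2
    using sum_Suc_diff'[of 1 "r + 1" "\<lambda>m. b n m (r + 2)"]
      sum_Suc_diff'[of "Suc (r + 1)" "n - 1" "\<lambda>m. b n m (r + 1)"] ts_first_row[of n "r + 2"]
    by (simp add: n_def)
  finally show ?thesis by (simp add: upper_entry_def lower_entry_def n_def add_ac)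
qed

lemma upper_entry_b_0: "upper_entry b 0 q r = 0"
  using ts_first_row[of "q + r + 3" "q + 2"] by (simp add: upper_entry_def)

lemma lower_entry_a_0:
  "lower_entry a 0 q (Suc r) = lower_entry b 0 q r"
  "lower_entry a 0 (Suc q) 0 = 0" "lower_entry a 0 0 0 = 1"
proof -
  \<comment> \<open>The plane \<open>p = 0\<close> is the last row but one of an A-matrix. As the
    row below is zero, it equals the last row of the preceding B-matrix.\<close>
  have *: "lower_entry a 0 q r = b (q + r + 2) (q + r + 2) (r + 1)" for q r
    using ts_diff(3)[of "q + r + 3" "r + 1" "q + r + 2"] ts_last_row[of "q + r + 3" "r + 1"]
    by (simp add: lower_entry_def eval_nat_numeral)
  show "lower_entry a 0 (Suc q) 0 = 0" "lower_entry a 0 0 0 = 1"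
    unfolding * using ts_corner by (simp_all add: eval_nat_numeral)
  \<comment> \<open>Both sides are the same column sum of order \<open>q + r + 2\<close>.\<close>
  show "lower_entry a 0 q (Suc r) = lower_entry b 0 q r"
    unfolding * using ts_col_sum(1)[of "q + r + 3" "r + 2"] ts_col_sum(2)[of "q + r + 3" "r + 1"]
    by (simp add: lower_entry_def eval_nat_numeral)
qed

text \<open>Only \<open>A\<^sub>n\<close> with odd \<open>n\<close> and \<open>B\<^sub>n\<close> with even \<open>n\<close> are coupled by the recurrences.  The other
  parity class, which is not governed by this system because of \<open>a\<^sub>2(1,1) = 1\<close>, is replaced
  by zero.\<close>

lemma seidel_system_entries:
  "seidel_system
     (\<lambda>p q r. if even (p + q + r) then of_int (upper_entry a p q r) else 0)
     (\<lambda>p q r. if even (p + q + r) then of_int (lower_entry a p q r) else 0)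
     (\<lambda>p q r. if odd (p + q + r) then of_int (upper_entry b p q r) else 0)
     (\<lambda>p q r. if odd (p + q + r) then of_int (lower_entry b p q r) else 0)"
proof -
  have diff:
    "real_of_int (upper_entry a (Suc p) q r) - of_int (upper_entry a p (Suc q) r) =
       - of_int (upper_entry b p q r)"
    "real_of_int (upper_entry b (Suc p) q r) - of_int (upper_entry b p (Suc q) r) =
       of_int (upper_entry a p q r)"
    "real_of_int (lower_entry a p (Suc q) r) - of_int (lower_entry a (Suc p) q r) =
       - of_int (lower_entry b p q r)"
    "real_of_int (lower_entry b p (Suc q) r) - of_int (lower_entry b (Suc p) q r) =
       of_int (lower_entry a p q r)" for p q r
    by (metis entry_diff of_int_diff of_int_minus)+
  \<comment> \<open>Odd parity rules out the exceptional case \<open>p = r = 0\<close>.\<close>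
  have "lower_entry b p 0 r = upper_entry b r 0 p" if "odd (p + r)" for p r
    using that by (intro entry_diagonal_b) (rule odd_pos)
  then show ?thesis
    unfolding seidel_system_def
    by (simp add: upper_entry_b_0 lower_entry_a_0 entry_diagonal_a diff add.commute
        del: even_add odd_add)
qed

end

section \<open>Operators on trivariate series\<close>

lemma fps3_eqI: "(\<And>p q r. coeff3 f p q r = coeff3 g p q r) \<Longrightarrow> f = g"
  by (intro fps_ext) (simp add: coeff3_def)

lemma coeff3_add [simp]: "coeff3 (f + g) p q r = coeff3 f p q r + coeff3 g p q r"
  by (simp add: coeff3_def)

lemma coeff3_diff [simp]: "coeff3 (f - g) p q r = coeff3 f p q r - coeff3 g p q r"
  by (simp add: coeff3_def)

lemma coeff3_uminus [simp]: "coeff3 (- f) p q r = - coeff3 f p q r"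
  by (simp add: coeff3_def)

lemma coeff3_of_nat_mult [simp]: "coeff3 (of_nat n * f) p q r = of_nat n * coeff3 f p q r"
  by (induction n) (simp_all add: coeff3_def algebra_simps)

lemma coeff3_mult:
  "coeff3 (f * g) p q r =
    (\<Sum>i=0..p. \<Sum>j=0..q. \<Sum>k=0..r. coeff3 f i j k * coeff3 g (p - i) (q - j) (r - k))"
  by (simp add: coeff3_def fps_mult_nth fps_sum_nth)

lemma coeff3_subst3:
  "coeff3 (subst3 f g) p q r = (\<Sum>n=0..p+q+r. fps_nth f n * coeff3 (g ^ n) p q r)"
  by (simp add: coeff3_def subst3_def)

text \<open>\<open>y\<close> and \<open>z\<close> live in the coefficients of the iterated series,
  so operations on them are coefficientwise, at depth one and two.\<close>

definition fps_map :: "('a \<Rightarrow> 'b) \<Rightarrow> 'a fps \<Rightarrow> 'b fps" where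
  "fps_map h f = Abs_fps (\<lambda>n. h (fps_nth f n))"

lemma fps_map_nth [simp]: "fps_nth (fps_map h f) n = h (fps_nth f n)"
  by (simp add: fps_map_def)

lemma fps_map_derivation:
  fixes d :: "'a::comm_ring_1 \<Rightarrow> 'a"
  assumes add: "\<And>x y. d (x + y) = d x + d y" and mult: "\<And>x y. d (x * y) = d x * y + x * d y"
  shows "fps_map d (f + g) = fps_map d f + fps_map d g"
    and "fps_map d (f * g) = fps_map d f * g + f * fps_map d g"
proof -
  have "d 0 = 0" using add[of 0 0] by simp
  then have "d (sum h A) = (\<Sum>x\<in>A. d (h x))" for h :: "nat \<Rightarrow> 'a" and A
    by (induction A rule: infinite_finite_induct) (simp_all add: add)
  then show "fps_map d (f * g) = fps_map d f * g + f * fps_map d g"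
    by (intro fps_ext) (simp add: fps_mult_nth mult sum.distrib)
qed (intro fps_ext; simp add: add)

lemma fps_map_hom:
  fixes d :: "'a::comm_ring_1 \<Rightarrow> 'a"
  assumes add: "\<And>x y. d (x + y) = d x + d y" and mult: "\<And>x y. d (x * y) = d x * d y"
    and one: "d 1 = 1"
  shows "fps_map d (f + g) = fps_map d f + fps_map d g"
    and "fps_map d (f * g) = fps_map d f * fps_map d g"
    and "fps_map d 1 = 1"
proof -
  have d0: "d 0 = 0" using add[of 0 0] by simp
  then have "d (sum h A) = (\<Sum>x\<in>A. d (h x))" for h :: "nat \<Rightarrow> 'a" and A
    by (induction A rule: infinite_finite_induct) (simp_all add: add)
  then show "fps_map d (f * g) = fps_map d f * fps_map d g"
    by (intro fps_ext) (simp add: fps_mult_nth mult)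
  show "fps_map d 1 = 1" using d0 one by (intro fps_ext) simp
qed (intro fps_ext; simp add: add)

text \<open>The substitution of \<open>g\<close> is truncated by total degree, so that an operator commutes with it
  as soon as each coefficient of the result is a multiple of a single coefficient of the
  argument, of the appropriate total degree.\<close>

locale fps3_hom =
  fixes \<phi> :: "fps3 \<Rightarrow> fps3"
  assumes coeff: "\<exists>w p' q' r'. p' + q' + r' = p + q + r \<and>
      (\<forall>h. coeff3 (\<phi> h) p q r = w * coeff3 h p' q' r')"
    and mult: "\<phi> (f * g) = \<phi> f * \<phi> g"
    and one: "\<phi> 1 = 1"
begin

lemma add: "\<phi> (f + g) = \<phi> f + \<phi> g"
proof (rule fps3_eqI)
  fix p q r
  show "coeff3 (\<phi> (f + g)) p q r = coeff3 (\<phi> f + \<phi> g) p q r"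
    using coeff[of p q r] by (auto simp: algebra_simps)
qed

lemma power: "\<phi> (f ^ n) = \<phi> f ^ n"
  by (induction n) (simp_all add: mult one)

lemma subst: "\<phi> (subst3 f g) = subst3 f (\<phi> g)"
proof (rule fps3_eqI)
  fix p q r
  obtain w p' q' r' where w: "p' + q' + r' = p + q + r"
    "\<And>h. coeff3 (\<phi> h) p q r = w * coeff3 h p' q' r'"
    using coeff[of p q r] by blast
  show "coeff3 (\<phi> (subst3 f g)) p q r = coeff3 (subst3 f (\<phi> g)) p q r"
    by (simp add: coeff3_subst3 w mult_ac sum_distrib_left flip: power)
qed

lemma sin3: "\<phi> (sin3 g) = sin3 (\<phi> g)" and cos3: "\<phi> (cos3 g) = cos3 (\<phi> g)"
  by (simp_all add: sin3_def cos3_def subst)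

lemmas simps = add mult power one sin3 cos3

end

section \<open>Derivations and the chain rule\<close>

locale fps3_derivation =
  fixes D :: "fps3 \<Rightarrow> fps3"
  assumes coeff: "\<exists>w p' q' r'. p' + q' + r' = Suc (p + q + r) \<and>
      (\<forall>h. coeff3 (D h) p q r = w * coeff3 h p' q' r')"
    and mult: "D (f * g) = D f * g + f * D g"
begin

lemma add: "D (f + g) = D f + D g"
proof (rule fps3_eqI)
  fix p q r
  show "coeff3 (D (f + g)) p q r = coeff3 (D f + D g) p q r"
    using coeff[of p q r] by (auto simp: algebra_simps)
qed

lemma one: "D 1 = 0"
  using mult[of 1 1] by simp

lemma power: "D (f ^ Suc n) = of_nat (Suc n) * f ^ n * D f"
  by (induction n) (simp_all add: mult one algebra_simps)

text \<open>Differentiation raises the truncation degree to \<open>p + q + r + 1\<close>; the term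
  \<open>n = 0\<close> drops out since \<open>D 1 = 0\<close>, and the index shift restores the
  bound of \<open>subst3\<close>.\<close>

lemma coeff_subst:
  "coeff3 (D (subst3 f g)) p q r =
    (\<Sum>n=0..p+q+r. fps_nth f (Suc n) * (of_nat (Suc n) * coeff3 (g ^ n * D g) p q r))"
proof -
  obtain w p' q' r' where w: "p' + q' + r' = Suc (p + q + r)"
    "\<And>h. coeff3 (D h) p q r = w * coeff3 h p' q' r'"
    using coeff[of p q r] by blast
  have "coeff3 (D (subst3 f g)) p q r =
      (\<Sum>n=0..Suc (p+q+r). fps_nth f n * coeff3 (D (g ^ n)) p q r)"
    unfolding coeff3_subst3 w sum_distrib_left by (simp only: mult_ac)
  also have "\<dots> = (\<Sum>n=0..p+q+r. fps_nth f (Suc n) * coeff3 (D (g ^ Suc n)) p q r)"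
    unfolding sum.atLeast0_atMost_Suc_shift by (simp add: one coeff3_def)
  finally show ?thesis
    unfolding power mult.assoc coeff3_of_nat_mult .
qed

text \<open>The arguments of sine and cosine below are sums of distinct variables, so
  \<open>D g\<close> is 1 or 0 and this case and the next one suffice.\<close>

lemma subst_1: "D g = 1 \<Longrightarrow> D (subst3 f g) = subst3 (fps_deriv f) g"
  by (rule fps3_eqI) (simp add: coeff_subst coeff3_subst3 mult_ac)

lemma subst_0: "D g = 0 \<Longrightarrow> D (subst3 f g) = 0"
  by (rule fps3_eqI) (simp add: coeff_subst, simp add: coeff3_def)

lemma sin3_0: "D g = 0 \<Longrightarrow> D (sin3 g) = 0" and cos3_0: "D g = 0 \<Longrightarrow> D (cos3 g) = 0"
  by (simp_all add: sin3_def cos3_def subst_0)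

lemma sin3_1: "D g = 1 \<Longrightarrow> D (sin3 g) = cos3 g"
  by (simp add: sin3_def cos3_def subst_1 fps_sin_deriv)

lemma cos3_1:
  assumes "D g = 1"
  shows "D (cos3 g) = - sin3 g"
  unfolding sin3_def cos3_def subst_1[OF assms] fps_cos_deriv
  by (rule fps3_eqI) (simp add: coeff3_subst3 sum_negf)

lemmas trig = sin3_0 sin3_1 cos3_0 cos3_1

end

section \<open>Partial derivatives, restrictions, and the exchange of \<open>x\<close> and
  \<open>z\<close>\<close>

definition deriv_x :: "fps3 \<Rightarrow> fps3" where "deriv_x = fps_deriv"
definition deriv_y :: "fps3 \<Rightarrow> fps3" where "deriv_y = fps_map fps_deriv"
definition deriv_z :: "fps3 \<Rightarrow> fps3" where "deriv_z = fps_map (fps_map fps_deriv)"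

definition set_x_0 :: "fps3 \<Rightarrow> fps3" where "set_x_0 f = fps_const (fps_nth f 0)"
definition set_y_0 :: "fps3 \<Rightarrow> fps3" where "set_y_0 = fps_map (\<lambda>f. fps_const (fps_nth f 0))"
definition set_z_0 :: "fps3 \<Rightarrow> fps3" where
  "set_z_0 = fps_map (fps_map (\<lambda>f. fps_const (fps_nth f 0)))"

text \<open>Expresses the diagonal conditions, where the first and third exponents are
  exchanged.\<close>

definition swap_xz :: "fps3 \<Rightarrow> fps3" where
  "swap_xz f = Abs_fps (\<lambda>p. Abs_fps (\<lambda>q. Abs_fps (\<lambda>r. coeff3 f r q p)))"

lemma coeff3_deriv:
  "coeff3 (deriv_x f) p q r = of_nat (Suc p) * coeff3 f (Suc p) q r"
  "coeff3 (deriv_y f) p q r = of_nat (Suc q) * coeff3 f p (Suc q) r"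
  "coeff3 (deriv_z f) p q r = of_nat (Suc r) * coeff3 f p q (Suc r)"
proof -
  have "fps_nth (fps_nth (of_nat n * h) q) r = of_nat n * fps_nth (fps_nth h q) r"
    for n and h :: "real fps fps"
    by (induction n) (simp_all add: algebra_simps)
  from this[of "Suc p"] show "coeff3 (deriv_x f) p q r = of_nat (Suc p) * coeff3 f (Suc p) q r"
    by (simp add: coeff3_def deriv_x_def del: of_nat_Suc)
  have "fps_nth (of_nat n * h) r = of_nat n * fps_nth h r" for n and h :: "real fps"
    by (induction n) (simp_all add: algebra_simps)
  from this[of "Suc q"] show "coeff3 (deriv_y f) p q r = of_nat (Suc q) * coeff3 f p (Suc q) r"
    by (simp add: coeff3_def deriv_y_def del: of_nat_Suc)
qed (simp add: coeff3_def deriv_z_def)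

lemma coeff3_set_0:
  "coeff3 (set_x_0 f) p q r = (if p = 0 then coeff3 f 0 q r else 0)"
  "coeff3 (set_y_0 f) p q r = (if q = 0 then coeff3 f p 0 r else 0)"
  "coeff3 (set_z_0 f) p q r = (if r = 0 then coeff3 f p q 0 else 0)"
  by (simp_all add: coeff3_def set_x_0_def set_y_0_def set_z_0_def)

lemma coeff3_swap_xz: "coeff3 (swap_xz f) p q r = coeff3 f r q p"
  by (simp add: swap_xz_def coeff3_def)

interpretation dx: fps3_derivation deriv_x
proof
  fix p q r show "\<exists>w p' q' r'. p' + q' + r' = Suc (p + q + r) \<and>
      (\<forall>h. coeff3 (deriv_x h) p q r = w * coeff3 h p' q' r')"
    unfolding coeff3_deriv by (intro exI[of _ "of_nat (Suc p)"] exI[of _ "Suc p"] exI) auto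
qed (simp add: deriv_x_def)

interpretation dy: fps3_derivation deriv_y
proof
  fix p q r show "\<exists>w p' q' r'. p' + q' + r' = Suc (p + q + r) \<and>
      (\<forall>h. coeff3 (deriv_y h) p q r = w * coeff3 h p' q' r')"
    unfolding coeff3_deriv
    by (intro exI[of _ "of_nat (Suc q)"] exI[of _ p] exI[of _ "Suc q"] exI) auto
  show "deriv_y (f * g) = deriv_y f * g + f * deriv_y g" for f g
    unfolding deriv_y_def by (intro fps_map_derivation) auto
qed

interpretation dz: fps3_derivation deriv_z
proof
  fix p q r show "\<exists>w p' q' r'. p' + q' + r' = Suc (p + q + r) \<and>
      (\<forall>h. coeff3 (deriv_z h) p q r = w * coeff3 h p' q' r')"
    unfolding coeff3_deriv
    by (intro exI[of _ "of_nat (Suc r)"] exI[of _ p] exI[of _ q] exI[of _ "Suc r"]) auto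
  show "deriv_z (f * g) = deriv_z f * g + f * deriv_z g" for f g
    unfolding deriv_z_def by (intro fps_map_derivation) auto
qed

interpretation x0: fps3_hom set_x_0
proof
  fix p q r show "\<exists>w p' q' r'. p' + q' + r' = p + q + r \<and>
      (\<forall>h. coeff3 (set_x_0 h) p q r = w * coeff3 h p' q' r')"
    unfolding coeff3_set_0 by (intro exI[of _ "if p = 0 then 1 else 0"] exI[of _ p] exI) auto
qed (simp_all add: set_x_0_def)

interpretation y0: fps3_hom set_y_0
proof
  fix p q r show "\<exists>w p' q' r'. p' + q' + r' = p + q + r \<and>
      (\<forall>h. coeff3 (set_y_0 h) p q r = w * coeff3 h p' q' r')"
    unfolding coeff3_set_0
    by (intro exI[of _ "if q = 0 then 1 else 0"] exI[of _ p] exI[of _ q] exI) auto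
  show "set_y_0 (f * g) = set_y_0 f * set_y_0 g" "set_y_0 1 = 1" for f g
    unfolding set_y_0_def by (intro fps_map_hom; simp)+
qed

interpretation z0: fps3_hom set_z_0
proof
  fix p q r show "\<exists>w p' q' r'. p' + q' + r' = p + q + r \<and>
      (\<forall>h. coeff3 (set_z_0 h) p q r = w * coeff3 h p' q' r')"
    unfolding coeff3_set_0
    by (intro exI[of _ "if r = 0 then 1 else 0"] exI[of _ p] exI[of _ q] exI[of _ r]) auto
  show "set_z_0 (f * g) = set_z_0 f * set_z_0 g" "set_z_0 1 = 1" for f g
    unfolding set_z_0_def by (intro fps_map_hom; simp)+
qed

interpretation xz: fps3_hom swap_xz
proof
  fix p q r show "\<exists>w p' q' r'. p' + q' + r' = p + q + r \<and>
      (\<forall>h. coeff3 (swap_xz h) p q r = w * coeff3 h p' q' r')"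
    unfolding coeff3_swap_xz
    by (intro exI[of _ 1] exI[of _ r] exI[of _ q] exI[of _ p]) auto
next
  fix f g :: fps3
  show "swap_xz (f * g) = swap_xz f * swap_xz g"
  proof (rule fps3_eqI)
    fix p q r
    \<comment> \<open>Three interchanges reverse the order of summation from \<open>i, j, k\<close>
      to \<open>k, j, i\<close>.\<close>
    have "coeff3 (f * g) r q p =
      (\<Sum>i=0..r. \<Sum>k=0..p. \<Sum>j=0..q. coeff3 f i j k * coeff3 g (r - i) (q - j) (p - k))"
      unfolding coeff3_mult by (intro sum.cong refl sum.swap)
    also have "\<dots> =
      (\<Sum>k=0..p. \<Sum>i=0..r. \<Sum>j=0..q. coeff3 f i j k * coeff3 g (r - i) (q - j) (p - k))"
      by (rule sum.swap)
    also have "\<dots> =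
      (\<Sum>k=0..p. \<Sum>j=0..q. \<Sum>i=0..r. coeff3 f i j k * coeff3 g (r - i) (q - j) (p - k))"
      by (intro sum.cong refl sum.swap)
    finally show "coeff3 (swap_xz (f * g)) p q r = coeff3 (swap_xz f * swap_xz g) p q r"
      by (simp add: coeff3_swap_xz coeff3_mult)
  qed
  show "swap_xz 1 = 1"
    by (rule fps3_eqI) (simp add: coeff3_swap_xz, simp add: coeff3_def)
qed

lemma op_vars [simp]:
  "deriv_x varx = 1" "deriv_x vary = 0" "deriv_x varz = 0"
  "deriv_y varx = 0" "deriv_y vary = 1" "deriv_y varz = 0"
  "deriv_z varx = 0" "deriv_z vary = 0" "deriv_z varz = 1"
  "set_x_0 varx = 0" "set_x_0 vary = vary" "set_x_0 varz = varz"
  "set_y_0 varx = varx" "set_y_0 vary = 0" "set_y_0 varz = varz"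
  "set_z_0 varx = varx" "set_z_0 vary = vary" "set_z_0 varz = 0"
  "swap_xz varx = varz" "swap_xz vary = vary" "swap_xz varz = varx"
  by (rule fps3_eqI, simp only: coeff3_deriv coeff3_set_0 coeff3_swap_xz,
      simp add: coeff3_def varx_def vary_def varz_def fps_X_def)+

lemma sin3_zero: "sin3 0 = 0"
proof -
  have *: "fps_nth (fps_sin 1) n * coeff3 (0 ^ n) p q r = 0" for n p q r
    by (cases n) (simp_all add: coeff3_def)
  show ?thesis
    unfolding sin3_def by (rule fps3_eqI) (simp only: coeff3_subst3 *, simp add: coeff3_def)
qed

section \<open>The generating functions\<close>

abbreviation cos_xyz :: fps3 where "cos_xyz \<equiv> cos3 (varx + vary + varz)"

definition over_cos2 :: "fps3 \<Rightarrow> fps3" where "over_cos2 f = f / cos_xyz ^ 2"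

text \<open>Clearing the factorials turns partial derivatives into index shifts.\<close>

definition egf_coeff :: "fps3 \<Rightarrow> nat \<Rightarrow> nat \<Rightarrow> nat \<Rightarrow> real" where
  "egf_coeff f p q r = coeff3 f p q r * (fact p * fact q * fact r)"

lemma egf_coeff_deriv:
  "egf_coeff f (Suc p) q r = egf_coeff (deriv_x f) p q r"
  "egf_coeff f p (Suc q) r = egf_coeff (deriv_y f) p q r"
  "egf_coeff f p q (Suc r) = egf_coeff (deriv_z f) p q r"
  by (simp_all add: egf_coeff_def coeff3_deriv)

lemma egf_coeff_set_0:
  "egf_coeff f 0 q r = egf_coeff (set_x_0 f) 0 q r"
  "egf_coeff f p 0 r = egf_coeff (set_y_0 f) p 0 r"
  "egf_coeff f p q 0 = egf_coeff (set_z_0 f) p q 0"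
  by (simp_all add: egf_coeff_def coeff3_set_0)

lemma egf_coeff_diff: "egf_coeff (f - g) p q r = egf_coeff f p q r - egf_coeff g p q r"
  and egf_coeff_uminus: "egf_coeff (- f) p q r = - egf_coeff f p q r"
  by (simp_all add: egf_coeff_def algebra_simps)

lemma over_cos2_mult: "over_cos2 f * cos_xyz ^ 2 = f"
  unfolding over_cos2_def by (rule fps3_divide_mult) (simp add: coeff3_cos3_square_0)

lemma cos3_nonzero: "cos3 g \<noteq> 0"
  using coeff3_cos3_square_0[of g] by (auto simp: coeff3_def)

lemma over_cos2_eqI: "g * cos_xyz ^ 2 = f \<Longrightarrow> g = over_cos2 f"
  using over_cos2_mult[of f] cos3_nonzero by (metis mult_right_cancel power_not_zero)

lemma over_cos2_uminus: "over_cos2 (- f) = - over_cos2 f"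
  by (rule over_cos2_eqI[symmetric]) (simp add: over_cos2_mult)

text \<open>The product rule is applied to \<open>over_cos2 f * cos_xyz ^ 2 = f\<close>; the two
  derivatives of the denominator agree, so their terms cancel in the difference.\<close>

lemma deriv_diff_over_cos2:
  "deriv_x (over_cos2 f) - deriv_y (over_cos2 f) = over_cos2 (deriv_x f - deriv_y f)"
proof (rule over_cos2_eqI)
  have "deriv_x f = deriv_x (over_cos2 f) * cos_xyz ^ 2 + over_cos2 f * deriv_x (cos_xyz ^ 2)"
    using dx.mult[of "over_cos2 f" "cos_xyz ^ 2"] by (simp add: over_cos2_mult)
  moreover have "deriv_y f =
      deriv_y (over_cos2 f) * cos_xyz ^ 2 + over_cos2 f * deriv_y (cos_xyz ^ 2)"
    using dy.mult[of "over_cos2 f" "cos_xyz ^ 2"] by (simp add: over_cos2_mult)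
  moreover have "deriv_x (cos_xyz ^ 2) = deriv_y (cos_xyz ^ 2)"
    by (simp add: power2_eq_square dx.mult dy.mult dx.trig dy.trig dx.add dy.add)
  ultimately show "(deriv_x (over_cos2 f) - deriv_y (over_cos2 f)) * cos_xyz ^ 2 =
      deriv_x f - deriv_y f"
    by (simp add: algebra_simps)
qed

section \<open>The four quotients satisfy the system\<close>

abbreviation gf_upper_a :: fps3 where "gf_upper_a \<equiv> over_cos2 (cos3 varx * cos3 varz)"
abbreviation gf_lower_a :: fps3 where
  "gf_lower_a \<equiv> over_cos2 (cos3 (varx + vary) * cos3 (vary + varz))"
abbreviation gf_upper_b :: fps3 where "gf_upper_b \<equiv> over_cos2 (sin3 varx * cos3 varz)"
abbreviation gf_lower_b :: fps3 where
  "gf_lower_b \<equiv> over_cos2 (cos3 (varx + vary) * sin3 (vary + varz))"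

text \<open>\<open>cos3 varz\<close> and \<open>cos3 (varx + vary)\<close> are annihilated. The
  other factor is differentiated by \<open>x\<close> in the upper case and by \<open>y\<close> with
  a minus sign in the lower, hence the opposite signs.\<close>

lemma gf_diff:
  "deriv_x gf_upper_a - deriv_y gf_upper_a = - gf_upper_b"
  "deriv_x gf_upper_b - deriv_y gf_upper_b = gf_upper_a"
  "deriv_x gf_lower_a - deriv_y gf_lower_a = gf_lower_b"
  "deriv_x gf_lower_b - deriv_y gf_lower_b = - gf_lower_a"
  unfolding deriv_diff_over_cos2 over_cos2_uminus[symmetric]
  by (simp_all add: dx.mult dy.mult dx.trig dy.trig dx.add dy.add)

lemma set_y_0_over_cos2: "set_y_0 (over_cos2 f) * cos3 (varx + varz) ^ 2 = set_y_0 f"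
  using arg_cong[OF over_cos2_mult[of f], of set_y_0] by (simp add: y0.simps)

text \<open>At \<open>y = 0\<close> the denominator is symmetric in \<open>x\<close> and
  \<open>z\<close>, so only the numerators have to match.\<close>

lemma gf_diagonal:
  assumes "swap_xz (set_y_0 f) = set_y_0 g"
  shows "egf_coeff (over_cos2 f) p 0 r = egf_coeff (over_cos2 g) r 0 p"
proof -
  have "swap_xz (set_y_0 (over_cos2 f)) * cos3 (varx + varz) ^ 2 = set_y_0 g"
    using arg_cong[OF set_y_0_over_cos2[of f], of swap_xz] assms
    by (simp add: xz.simps add.commute)
  then have *: "swap_xz (set_y_0 (over_cos2 f)) = set_y_0 (over_cos2 g)"
    using set_y_0_over_cos2[of g] cos3_nonzero by (metis mult_right_cancel power_not_zero)
  show ?thesis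
    unfolding egf_coeff_set_0(2)[of "over_cos2 f"] egf_coeff_set_0(2)[of "over_cos2 g"]
      *[symmetric]
    by (simp add: egf_coeff_def coeff3_swap_xz)
qed

lemma set_x_0_over_cos2: "set_x_0 (over_cos2 f) * cos3 (vary + varz) ^ 2 = set_x_0 f"
  using arg_cong[OF over_cos2_mult[of f], of set_x_0] by (simp add: x0.simps)

lemma gf_upper_b_x_0: "set_x_0 gf_upper_b = 0"
proof -
  have "set_x_0 gf_upper_b * cos3 (vary + varz) ^ 2 = 0"
    unfolding set_x_0_over_cos2 x0.mult by (simp add: x0.sin3 sin3_zero)
  then show ?thesis using cos3_nonzero by simp
qed

text \<open>One factor of the denominator cancels, leaving cos y / cos (y + z).\<close>

lemma gf_lower_a_x_0: "set_x_0 gf_lower_a * cos3 (vary + varz) = cos3 vary"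
proof -
  have "set_x_0 gf_lower_a * cos3 (vary + varz) ^ 2 = cos3 vary * cos3 (vary + varz)"
    unfolding set_x_0_over_cos2 by (simp add: x0.simps)
  then show ?thesis using cos3_nonzero by (simp add: power2_eq_square flip: mult.assoc)
qed

text \<open>The z-derivative of cos y / cos (y + z) is cos y sin (y + z) / cos^2 (y + z).\<close>

lemma gf_lower_x_0: "deriv_z (set_x_0 gf_lower_a) = set_x_0 gf_lower_b"
proof -
  let ?c = "cos3 (vary + varz)" and ?s = "sin3 (vary + varz)"
  have "deriv_z (set_x_0 gf_lower_a) * ?c = set_x_0 gf_lower_a * ?s"
    using arg_cong[OF gf_lower_a_x_0, of deriv_z] by (simp add: dz.mult dz.trig dz.add)
  then have "deriv_z (set_x_0 gf_lower_a) * ?c ^ 2 = cos3 vary * ?s"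
    using gf_lower_a_x_0 by (simp add: power2_eq_square mult_ac flip: gf_lower_a_x_0)
  also have "\<dots> = set_x_0 gf_lower_b * ?c ^ 2"
    unfolding set_x_0_over_cos2 by (simp add: x0.simps)
  finally show ?thesis using cos3_nonzero by simp
qed

text \<open>The quotient becomes cos y / cos y, which yields the constants 0 and 1 of the
  system.\<close>

lemma gf_lower_a_xz_0: "set_z_0 (set_x_0 gf_lower_a) = 1"
proof -
  have "set_z_0 (set_x_0 gf_lower_a) * cos3 vary = cos3 vary"
    using arg_cong[OF gf_lower_a_x_0, of set_z_0] by (simp add: z0.simps)
  then show ?thesis using cos3_nonzero by simp
qed

lemma set_x_0_deriv_z: "set_x_0 (deriv_z f) = deriv_z (set_x_0 f)"
  by (rule fps3_eqI) (simp add: coeff3_deriv coeff3_set_0)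

lemma seidel_system_gf:
  "seidel_system (egf_coeff gf_upper_a) (egf_coeff gf_lower_a)
     (egf_coeff gf_upper_b) (egf_coeff gf_lower_b)"
  unfolding seidel_system_def
proof (intro conjI allI)
  fix p q r
  show "egf_coeff gf_upper_a (Suc p) q r - egf_coeff gf_upper_a p (Suc q) r = - egf_coeff gf_upper_b p q r"
    and "egf_coeff gf_upper_b (Suc p) q r - egf_coeff gf_upper_b p (Suc q) r =
        egf_coeff gf_upper_a p q r"
    by (simp_all only: egf_coeff_deriv gf_diff egf_coeff_uminus flip: egf_coeff_diff)
  have "egf_coeff gf_lower_a (Suc p) q r - egf_coeff gf_lower_a p (Suc q) r = egf_coeff gf_lower_b p q r"
    and "egf_coeff gf_lower_b (Suc p) q r - egf_coeff gf_lower_b p (Suc q) r =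
        - egf_coeff gf_lower_a p q r"
    by (simp_all only: egf_coeff_deriv gf_diff egf_coeff_uminus flip: egf_coeff_diff)
  then show "egf_coeff gf_lower_a p (Suc q) r - egf_coeff gf_lower_a (Suc p) q r = - egf_coeff gf_lower_b p q r"
    and "egf_coeff gf_lower_b p (Suc q) r - egf_coeff gf_lower_b (Suc p) q r =
        egf_coeff gf_lower_a p q r"
    by simp_all
  show "egf_coeff gf_upper_a p 0 r = egf_coeff gf_lower_a r 0 p"
    and "egf_coeff gf_lower_b p 0 r = egf_coeff gf_upper_b r 0 p"
    by (rule gf_diagonal; simp add: y0.simps xz.simps)+
  show "egf_coeff gf_upper_b 0 q r = 0"
    unfolding egf_coeff_set_0(1)[of gf_upper_b] gf_upper_b_x_0 by (simp add: egf_coeff_def coeff3_def)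
  show "egf_coeff gf_lower_a 0 q (Suc r) = egf_coeff gf_lower_b 0 q r"
    unfolding egf_coeff_deriv(3)
    by (metis egf_coeff_set_0(1) set_x_0_deriv_z gf_lower_x_0)
  have *: "egf_coeff gf_lower_a 0 q 0 = egf_coeff 1 0 q 0" for q
    by (metis egf_coeff_set_0(1,3) gf_lower_a_xz_0)
  show "egf_coeff gf_lower_a 0 (Suc q) 0 = 0" and "egf_coeff gf_lower_a 0 0 0 = 1"
    unfolding * by (simp_all add: egf_coeff_def coeff3_def)
qed

lemma coeff3_monomial:
  "coeff3 (const3 c * varx ^ i * vary ^ j * varz ^ k) p q r =
    (if p = i \<and> q = j \<and> r = k then c else 0)"
proof -
  have "const3 c * varx ^ i * vary ^ j * varz ^ k =
      fps_const (fps_const (fps_const c * fps_X ^ k) * fps_X ^ j) * fps_X ^ i"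
    by (simp add: const3_def varx_def vary_def varz_def fps_const_power mult_ac flip: fps_const_mult)
  then show ?thesis
    by (simp add: coeff3_def fps_X_power_mult_right_nth fps_X_power_nth)
qed

text \<open>Injectivity of the exponent map \<open>e\<close> leaves at most one summand per
  monomial, so finiteness is clear and coefficients can be compared one by one.\<close>

lemma has_formal_sum_monomials:
  assumes inj: "inj_on e I"
    and F: "\<And>i p q r. i \<in> I \<Longrightarrow> coeff3 (F i) p q r = (if e i = (p, q, r) then c i else 0)"
    and in_I: "\<And>i p q r. i \<in> I \<Longrightarrow> e i = (p, q, r) \<Longrightarrow> coeff3 S p q r = c i"
    and not_in_I: "\<And>p q r. (p, q, r) \<notin> e ` I \<Longrightarrow> coeff3 S p q r = 0"
  shows "has_formal_sum F I S"
  unfolding has_formal_sum_def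
proof (intro allI)
  fix p q r
  show "finite {i \<in> I. coeff3 (F i) p q r \<noteq> 0} \<and>
      coeff3 S p q r = (\<Sum>i | i \<in> I \<and> coeff3 (F i) p q r \<noteq> 0. coeff3 (F i) p q r)"
  proof (cases "(p, q, r) \<in> e ` I")
    case True
    then obtain i where i: "i \<in> I" "e i = (p, q, r)" by (metis imageE)
    have coeff: "coeff3 (F j) p q r = (if j = i then c i else 0)" if "j \<in> I" for j
    proof -
      have "e j = (p, q, r) \<longleftrightarrow> j = i" using i inj that by (metis inj_onD)
      then show ?thesis unfolding F[OF that] by simp
    qed
    have "{i \<in> I. coeff3 (F i) p q r \<noteq> 0} = (if c i = 0 then {} else {i})"
      using i(1) coeff by (auto split: if_splits)
    then show ?thesis using in_I[OF i] coeff[OF i(1)] by simp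
  next
    case False
    then have *: "{i \<in> I. coeff3 (F i) p q r \<noteq> 0} = {}" by (force simp: F)
    show ?thesis unfolding * using False by (simp add: not_in_I)
  qed
qed

section \<open>Comparison of coefficients\<close>

theorem theorem1p5:
  fixes a b :: "nat \<Rightarrow> nat \<Rightarrow> nat \<Rightarrow> int"
  assumes "twin_seidel a b"
  shows
    "has_formal_sum
       (\<lambda>(n, m, k). const3 (of_int (b (2*n) m k) / (fact (m-1) * fact (k-m-1) * fact (2*n-1-k)))
                      * varx ^ (m-1) * vary ^ (k-m-1) * varz ^ (2*n-1-k))
       {(n, m, k). 1 \<le> n \<and> 2 \<le> m+1 \<and> m+1 \<le> k \<and> k \<le> 2*n-1}
       (sin3 varx * cos3 varz / cos3 (varx + vary + varz) ^ 2)
     \<and>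
     has_formal_sum
       (\<lambda>(n, m, k). const3 (of_int (b (2*n) m k) / (fact (2*n-m-1) * fact (m-k-1) * fact (k-1)))
                      * varx ^ (2*n-m-1) * vary ^ (m-k-1) * varz ^ (k-1))
       {(n, m, k). 1 \<le> n \<and> 2 \<le> k+1 \<and> k+1 \<le> m \<and> m \<le> 2*n-1}
       (cos3 (varx + vary) * sin3 (vary + varz) / cos3 (varx + vary + varz) ^ 2)"
proof -
  have coeff: "coeff3 f p q r = egf_coeff f p q r / (fact p * fact q * fact r)" for f p q r
    by (simp add: egf_coeff_def)
  \<comment> \<open>Order \<open>2 * n\<close> corresponds to total degree \<open>2 * n - 3\<close>,
    so exactly the odd degrees carry entries of \<open>b\<close>.\<close>
  have upper: "egf_coeff gf_upper_b p q r =
      (if odd (p + q + r) then of_int (upper_entry b p q r) else 0)"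
    and lower: "egf_coeff gf_lower_b p q r =
      (if odd (p + q + r) then of_int (lower_entry b p q r) else 0)" for p q r
    using seidel_system_unique[OF seidel_system_gf seidel_system_entries[OF assms]] by simp_all
  show ?thesis
  proof (rule conjI; fold over_cos2_def)
    let ?e = "\<lambda>(n, m, k). (m-1, k-m-1, 2*n-1-k)"
    show "has_formal_sum
       (\<lambda>(n, m, k). const3 (of_int (b (2*n) m k) / (fact (m-1) * fact (k-m-1) * fact (2*n-1-k)))
                      * varx ^ (m-1) * vary ^ (k-m-1) * varz ^ (2*n-1-k))
       {(n, m, k). 1 \<le> n \<and> 2 \<le> m+1 \<and> m+1 \<le> k \<and> k \<le> 2*n-1} gf_upper_b"
      (is "has_formal_sum _ ?I _")
    proof (rule has_formal_sum_monomials[where e = ?e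
          and c = "\<lambda>(n, m, k). of_int (b (2*n) m k) / (fact (m-1) * fact (k-m-1) * fact (2*n-1-k))"],
        goal_cases)
      case 1
      show ?case
        by (rule inj_on_inverseI[where g =
            "\<lambda>(p, q, r). ((p + q + r + 3) div 2, p + 1, p + q + 2)"]) auto
    next
      case (2 i p q r)
      then show ?case by (auto simp: coeff3_monomial split: prod.splits)
    next
      case (3 i p q r)
      then obtain n m k where i: "i = (n, m, k)" "n \<ge> 1" "m \<ge> 1" "m + 1 \<le> k" "k \<le> 2*n-1"
        by auto
      \<comment> \<open>The bounds force \<open>n \<ge> 2\<close>, so the subtraction
        \<open>n - 2\<close> is not truncated.\<close>
      have "p + q + r = 2 * (n - 2) + 1" and *: "p = m - 1" "q = k - m - 1" "r = 2*n-1-k"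
        using 3 i by auto
      then have "odd (p + q + r)" and entry: "p + q + r + 3 = 2 * n" "p + 1 = m" "p + q + 2 = k"
        using i by auto
      then have "coeff3 gf_upper_b p q r = of_int (b (2*n) m k) / (fact p * fact q * fact r)"
        unfolding coeff upper upper_entry_def entry by simp
      then show ?case by (simp add: i(1) *)
    next
      case (4 p q r)
      \<comment> \<open>Every triple of odd degree is the image of an index in \<open>?I\<close>; on
        even degrees the series vanishes.\<close>
      have "even (p + q + r)"
      proof (rule ccontr)
        assume "odd (p + q + r)"
        then have "even (p + q + r + 3)" by simp
        then obtain n where "p + q + r + 3 = 2 * n" by (rule evenE)
        then have "(n, p + 1, p + q + 2) \<in> ?I" and "?e (n, p + 1, p + q + 2) = (p, q, r)"
          by auto
        then show False using 4 by (metis (no_types, lifting) image_eqI)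
      qed
      then show ?case by (simp add: coeff upper del: even_add odd_add)
    qed
  next
    let ?e = "\<lambda>(n, m, k). (2*n-m-1, m-k-1, k-1)"
    show "has_formal_sum
       (\<lambda>(n, m, k). const3 (of_int (b (2*n) m k) / (fact (2*n-m-1) * fact (m-k-1) * fact (k-1)))
                      * varx ^ (2*n-m-1) * vary ^ (m-k-1) * varz ^ (k-1))
       {(n, m, k). 1 \<le> n \<and> 2 \<le> k+1 \<and> k+1 \<le> m \<and> m \<le> 2*n-1} gf_lower_b"
      (is "has_formal_sum _ ?I _")
    proof (rule has_formal_sum_monomials[where e = ?e
          and c = "\<lambda>(n, m, k). of_int (b (2*n) m k) / (fact (2*n-m-1) * fact (m-k-1) * fact (k-1))"],
        goal_cases)
      case 1
      show ?case
        by (rule inj_on_inverseI[where g =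
            "\<lambda>(p, q, r). ((p + q + r + 3) div 2, q + r + 2, r + 1)"]) auto
    next
      case (2 i p q r)
      then show ?case by (auto simp: coeff3_monomial split: prod.splits)
    next
      case (3 i p q r)
      then obtain n m k where i: "i = (n, m, k)" "n \<ge> 1" "k \<ge> 1" "k + 1 \<le> m" "m \<le> 2*n-1"
        by auto
      \<comment> \<open>Again \<open>n \<ge> 2\<close>, now from \<open>2 \<le> m\<close> and
        \<open>m \<le> 2*n-1\<close>.\<close>
      have "p + q + r = 2 * (n - 2) + 1" and *: "p = 2*n-m-1" "q = m - k - 1" "r = k - 1"
        using 3 i by auto
      then have "odd (p + q + r)" and entry: "p + q + r + 3 = 2 * n" "q + r + 2 = m" "r + 1 = k"
        using i by auto
      then have "coeff3 gf_lower_b p q r = of_int (b (2*n) m k) / (fact p * fact q * fact r)"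
        unfolding coeff lower lower_entry_def entry by simp
      then show ?case by (simp add: i(1) *)
    next
      case (4 p q r)
      have "even (p + q + r)"
      proof (rule ccontr)
        assume "odd (p + q + r)"
        then have "even (p + q + r + 3)" by simp
        then obtain n where "p + q + r + 3 = 2 * n" by (rule evenE)
        then have "(n, q + r + 2, r + 1) \<in> ?I" and "?e (n, q + r + 2, r + 1) = (p, q, r)"
          by auto
        then show False using 4 by (metis (no_types, lifting) image_eqI)
      qed
      then show ?case by (simp add: coeff lower del: even_add odd_add)
    qed
  qed
qed

end
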